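(* Let $\lambda$ be a Young diagram (a finite set of cells $(i,j)$, $i$ the row and $j$ the column, $i,j\geq1$, such that $(i,j)\in\lambda$, $1\leq i'\leq i$, $1\leq j'\leq j$ imply $(i',j')\in\lambda$), and let $d$ be the length of its diagonal: $(d,d)\in\lambda$, $(d+1,d+1)\notin\lambda$. Work over $\mathbb{Z}[x]=\mathbb{Z}[x_s:s\in\lambda]$ with independent indeterminates $x_s$. For $1\leq i,j\leq d+1$ let $\lambda(i,j)=\{(u,v)\in\lambda: i\leq u,\ j\leq v\}$, $A_{ij}=F(\lambda(i,j))$ and $A(\lambda)=(A_{ij})_{1\leq i,j\leq d+1}$. Then $A(\lambda)=UDL$, where (i) $U=(U_{ik})_{1\leq i,k\leq d+1}$ with $U_{ik}=F(U(i,k))$ for $i\leq k$, where $U(i,k)=\{(u,v)\in\lambda: i\leq u<k\leq v\}$, and $U_{ik}=0$ for $i>k$; (ii) $D=\mathrm{diag}(D_{11},\ldots,D_{d+1,d+1})$ with $D_{kk}=\prod_{s\in\lambda(k,k)}x_s$; (iii) $L=(L_{kj})_{1\leq k,j\leq d+1}$ with $L_{kj}=F(L(k,j))$ for $j\leq k$, where $L(k,j)=\{(u,v)\in\lambda: j\leq v<k\leq u\}$, and $L_{kj}=0$ for $j>k$; and in particular $U$ is upper unitriangular and $L$ is lower unitriangular.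
   Context: For a finite set $S$ of cells, call $\mu\subseteq S$ an initial subshape of $S$ if whenever $(u,v)\in\mu$, $(u',v')\in S$, $u'\leq u$ and $v'\leq v$, then $(u',v')\in\mu$ (the empty set is allowed). The generating function for skew shapes of $S$ is $F(S)=\sum_{\mu}\prod_{s\in S\setminus\mu}x_s$, the sum over all initial subshapes $\mu$ of $S$; in particular $F(\emptyset)=1$. Empty products equal $1$. *)

theory Defs
  imports "Jordan_Normal_Form.Matrix" "HOL-Library.Poly_Mapping"
begin

type_synonym cell = "nat \<times> nat"

text \<open>
  Integer polynomials in independent indeterminates indexed by cells: finitely supported maps from
  monomials (finitely supported exponent functions) to \<open>int\<close>, with the convolution product of
  \<^theory>\<open>HOL-Library.Poly_Mapping\<close>. The variables range over all of \<open>nat \<times> nat\<close>;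
  the polynomial ring over the cells of a fixed diagram is the subring of polynomials in the
  indeterminates of that diagram, and every polynomial below lies in it.
\<close>

type_synonym cell_poly = "(cell \<Rightarrow>\<^sub>0 nat) \<Rightarrow>\<^sub>0 int"

definition indet :: "cell \<Rightarrow> cell_poly" where
  "indet s = Poly_Mapping.single (Poly_Mapping.single s 1) 1"

definition young_diagram :: "cell set \<Rightarrow> bool" where
  "young_diagram lam \<longleftrightarrow> finite lam \<and>
     (\<forall>(i, j)\<in>lam. 1 \<le> i \<and> 1 \<le> j) \<and>
     (\<forall>i j i' j'. (i, j) \<in> lam \<and> 1 \<le> i' \<and> i' \<le> i \<and> 1 \<le> j' \<and> j' \<le> j \<longrightarrow> (i', j') \<in> lam)"

text \<open>The disjunct \<open>d = 0\<close> covers the empty diagram, whose diagonal has length 0.\<close>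

definition diagonal_length :: "cell set \<Rightarrow> nat \<Rightarrow> bool" where
  "diagonal_length lam d \<longleftrightarrow> (d = 0 \<or> (d, d) \<in> lam) \<and> (d + 1, d + 1) \<notin> lam"

definition initial_subshape :: "cell set \<Rightarrow> cell set \<Rightarrow> bool" where
  "initial_subshape \<mu> S \<longleftrightarrow> \<mu> \<subseteq> S \<and>
     (\<forall>u v u' v'. (u, v) \<in> \<mu> \<and> (u', v') \<in> S \<and> u' \<le> u \<and> v' \<le> v \<longrightarrow> (u', v') \<in> \<mu>)"

definition skew_gf :: "cell set \<Rightarrow> cell_poly" where
  "skew_gf S = (\<Sum>\<mu> | initial_subshape \<mu> S. \<Prod>s\<in>S - \<mu>. indet s)"

definition corner_region :: "cell set \<Rightarrow> nat \<Rightarrow> nat \<Rightarrow> cell set" where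
  "corner_region lam i j = {(u, v) \<in> lam. i \<le> u \<and> j \<le> v}"

definition upper_region :: "cell set \<Rightarrow> nat \<Rightarrow> nat \<Rightarrow> cell set" where
  "upper_region lam i k = {(u, v) \<in> lam. i \<le> u \<and> u < k \<and> k \<le> v}"

definition lower_region :: "cell set \<Rightarrow> nat \<Rightarrow> nat \<Rightarrow> cell set" where
  "lower_region lam k j = {(u, v) \<in> lam. j \<le> v \<and> v < k \<and> k \<le> u}"

text \<open>
  Matrices of type \<open>mat\<close> are indexed from 0, rows and columns of the diagram from 1; hence
  the shift by \<open>Suc\<close> in the following definitions.
\<close>

definition A_mat :: "cell set \<Rightarrow> nat \<Rightarrow> cell_poly mat" where
  "A_mat lam d = mat (d + 1) (d + 1) (\<lambda>(i, j). skew_gf (corner_region lam (Suc i) (Suc j)))"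

definition U_mat :: "cell set \<Rightarrow> nat \<Rightarrow> cell_poly mat" where
  "U_mat lam d = mat (d + 1) (d + 1)
     (\<lambda>(i, k). if i \<le> k then skew_gf (upper_region lam (Suc i) (Suc k)) else 0)"

definition D_mat :: "cell set \<Rightarrow> nat \<Rightarrow> cell_poly mat" where
  "D_mat lam d = mat_diag (d + 1) (\<lambda>k. \<Prod>s\<in>corner_region lam (Suc k) (Suc k). indet s)"

definition L_mat :: "cell set \<Rightarrow> nat \<Rightarrow> cell_poly mat" where
  "L_mat lam d = mat (d + 1) (d + 1)
     (\<lambda>(k, j). if j \<le> k then skew_gf (lower_region lam (Suc k) (Suc j)) else 0)"

definition upper_unitriangular :: "'a :: zero_neq_one mat \<Rightarrow> bool" where
  "upper_unitriangular M \<longleftrightarrow> square_mat M \<and> upper_triangular M \<and> (\<forall>i<dim_row M. M $$ (i, i) = 1)"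

definition lower_unitriangular :: "'a :: zero_neq_one mat \<Rightarrow> bool" where
  "lower_unitriangular M \<longleftrightarrow> upper_unitriangular (transpose_mat M)"

end

(*
  Sort the initial subshapes \<mu> of lambda(i,j) by the first diagonal cell (k,k), k \<ge> max i j,
  that \<mu> misses. Such a \<mu> contains all cells with u < k and v < k and no cell with
  u \<ge> k and v \<ge> k, and its traces on U(i,k) and L(k,j) are arbitrary initial subshapes,
  chosen independently. Summing over k gives the (i,j) entry of UDL.
*)
theory Submission
  imports Defs
begin

text \<open>Of the four blocks into which comparing u and v with k cuts lambda(i,j), this is the one
  before (k,k) in both coordinates; the others are \<open>upper_region\<close>,
  \<open>lower_region\<close> and \<open>corner_region\<close> at (k,k).\<close>

definition square_region :: "cell set \<Rightarrow> nat \<Rightarrow> nat \<Rightarrow> nat \<Rightarrow> cell set" where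
  "square_region lam i j k = {(u, v) \<in> lam. i \<le> u \<and> u < k \<and> j \<le> v \<and> v < k}"

text \<open>Being cut at k is encoded by what it forces on whole blocks, not by a condition on
  diagonal cells. Only the traces on the other two blocks then remain free.\<close>

definition subshapes_cut_at :: "cell set \<Rightarrow> nat \<Rightarrow> nat \<Rightarrow> nat \<Rightarrow> cell set set" where
  "subshapes_cut_at lam i j k =
     {\<mu>. initial_subshape \<mu> (corner_region lam i j) \<and> square_region lam i j k \<subseteq> \<mu> \<and>
       \<mu> \<inter> corner_region lam k k = {}}"

lemmas region_defs = corner_region_def upper_region_def lower_region_def square_region_def

lemma finite_initial_subshapes:
  assumes "finite S"
  shows "finite {\<mu>. initial_subshape \<mu> S}"
  by (rule finite_subset[of _ "Pow S"]) (use assms in \<open>auto simp: initial_subshape_def\<close>)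

lemma skew_gf_empty [simp]: "skew_gf {} = 1"
proof -
  have "{\<mu>. initial_subshape \<mu> {}} = {{}}"
    by (auto simp: initial_subshape_def)
  then show ?thesis
    by (simp add: skew_gf_def)
qed

lemma initial_subshapeD:
  assumes "initial_subshape \<mu> S" "(u, v) \<in> \<mu>" "(u', v') \<in> S" "u' \<le> u" "v' \<le> v"
  shows "(u', v') \<in> \<mu>"
  using assms unfolding initial_subshape_def by blast

lemma initial_subshape_subset: "initial_subshape \<mu> S \<Longrightarrow> \<mu> \<subseteq> S"
  by (simp add: initial_subshape_def)

lemma initial_subshape_Int:
  assumes "initial_subshape \<mu> S" "T \<subseteq> S"
  shows "initial_subshape (\<mu> \<inter> T) T"
  using assms unfolding initial_subshape_def by blast

lemma corner_region_decomp:
  assumes "i \<le> k" "j \<le> k"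
  shows "corner_region lam i j =
    square_region lam i j k \<union> upper_region lam i k \<union> lower_region lam k j \<union> corner_region lam k k"
  using assms by (auto simp: region_defs)

text \<open>Decreasing coordinates from a cell of \<alpha> keeps the row below k, so it ends in the
  upper block, where \<alpha> is closed, or in the square, which is included entirely. Columns do
  the same for \<beta>. Hence \<alpha> and \<beta> impose no condition on each other.\<close>

lemma initial_subshape_glue:
  assumes k: "i \<le> k" "j \<le> k"
    and \<alpha>: "initial_subshape \<alpha> (upper_region lam i k)"
    and \<beta>: "initial_subshape \<beta> (lower_region lam k j)"
  shows "initial_subshape (square_region lam i j k \<union> \<alpha> \<union> \<beta>) (corner_region lam i j)"
    (is "initial_subshape ?\<mu> ?C")
  unfolding initial_subshape_def
proof (intro conjI allI impI)
  show "?\<mu> \<subseteq> ?C"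
    using initial_subshape_subset[OF \<alpha>] initial_subshape_subset[OF \<beta>]
      corner_region_decomp[OF k, of lam] by blast
  fix u v u' v'
  assume *: "(u, v) \<in> ?\<mu> \<and> (u', v') \<in> ?C \<and> u' \<le> u \<and> v' \<le> v"
  then have C: "(u', v') \<in> lam" "i \<le> u'" "j \<le> v'"
    by (auto simp: corner_region_def)
  from * consider "(u, v) \<in> square_region lam i j k" | "(u, v) \<in> \<alpha>" | "(u, v) \<in> \<beta>"
    by blast
  then show "(u', v') \<in> ?\<mu>"
  proof cases
    case 1
    then show ?thesis
      using * C by (auto simp: square_region_def)
  next
    case 2
    then have "u' < k"
      using initial_subshape_subset[OF \<alpha>] * by (auto simp: upper_region_def)
    then show ?thesis
      using C * initial_subshapeD[OF \<alpha> 2, of u' v']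
      by (cases "k \<le> v'") (auto simp: upper_region_def square_region_def)
  next
    case 3
    then have "v' < k"
      using initial_subshape_subset[OF \<beta>] * by (auto simp: lower_region_def)
    then show ?thesis
      using C * initial_subshapeD[OF \<beta> 3, of u' v']
      by (cases "k \<le> u'") (auto simp: lower_region_def square_region_def)
  qed
qed

text \<open>Taking traces on the upper and lower blocks is a bijection onto pairs of initial
  subshapes, with gluing as its inverse, and the weight is multiplicative along it.\<close>

lemma sum_subshapes_cut_at:
  assumes fin: "finite lam" and k: "i \<le> k" "j \<le> k"
  shows "(\<Sum>\<mu>\<in>subshapes_cut_at lam i j k. \<Prod>s\<in>corner_region lam i j - \<mu>. indet s) =
    skew_gf (upper_region lam i k) * (\<Prod>s\<in>corner_region lam k k. indet s) *
    skew_gf (lower_region lam k j)"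
proof -
  let ?U = "upper_region lam i k" and ?L = "lower_region lam k j"
    and ?Q = "square_region lam i j k" and ?D = "corner_region lam k k"
    and ?C = "corner_region lam i j"
  let ?I = "\<lambda>S. {\<mu>. initial_subshape \<mu> S}"
  have disj: "?U \<inter> ?L = {}" "?U \<inter> ?D = {}" "?L \<inter> ?D = {}" "?Q \<inter> ?U = {}" "?Q \<inter> ?L = {}"
    "?Q \<inter> ?D = {}"
    by (auto simp: region_defs)
  have fins: "finite ?U" "finite ?L" "finite ?D"
    by (rule finite_subset[OF _ fin]; auto simp: region_defs)+
  note decomp = corner_region_decomp[OF k, of lam]
  have "(\<Sum>\<mu>\<in>subshapes_cut_at lam i j k. \<Prod>s\<in>?C - \<mu>. indet s) =
      (\<Sum>(\<alpha>, \<beta>)\<in>?I ?U \<times> ?I ?L. (\<Prod>s\<in>?U - \<alpha>. indet s) * (\<Prod>s\<in>?D. indet s) * (\<Prod>s\<in>?L - \<beta>. indet s))"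
  proof (rule sum.reindex_bij_witness[where j = "\<lambda>\<mu>. (\<mu> \<inter> ?U, \<mu> \<inter> ?L)"
        and i = "\<lambda>(\<alpha>, \<beta>). ?Q \<union> \<alpha> \<union> \<beta>"])
    fix \<mu>
    assume "\<mu> \<in> subshapes_cut_at lam i j k"
    then have \<mu>: "initial_subshape \<mu> ?C" "?Q \<subseteq> \<mu>" "\<mu> \<inter> ?D = {}"
      by (simp_all add: subshapes_cut_at_def)
    note sub = initial_subshape_subset[OF \<mu>(1)]
    show "(case (\<mu> \<inter> ?U, \<mu> \<inter> ?L) of (\<alpha>, \<beta>) \<Rightarrow> ?Q \<union> \<alpha> \<union> \<beta>) = \<mu>"
      using sub \<mu> decomp by auto
    show "(\<mu> \<inter> ?U, \<mu> \<inter> ?L) \<in> ?I ?U \<times> ?I ?L"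
      using initial_subshape_Int[OF \<mu>(1)] decomp by auto
    \<comment> \<open>The square contributes nothing to the complement and the block at (k,k)
      contributes all of its cells.\<close>
    have "?C - \<mu> = (?U - \<mu> \<inter> ?U) \<union> ?D \<union> (?L - \<mu> \<inter> ?L)"
      using decomp \<mu> by blast
    moreover have "(\<Prod>s\<in>(?U - \<mu> \<inter> ?U) \<union> ?D \<union> (?L - \<mu> \<inter> ?L). indet s) =
        (\<Prod>s\<in>?U - \<mu> \<inter> ?U. indet s) * (\<Prod>s\<in>?D. indet s) * (\<Prod>s\<in>?L - \<mu> \<inter> ?L. indet s)"
    proof -
      have "(?U - \<mu> \<inter> ?U) \<inter> ?D = {}" "((?U - \<mu> \<inter> ?U) \<union> ?D) \<inter> (?L - \<mu> \<inter> ?L) = {}"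
        using disj by blast+
      then show ?thesis
        using fins by (simp add: prod.union_disjoint)
    qed
    ultimately show "(case (\<mu> \<inter> ?U, \<mu> \<inter> ?L) of (\<alpha>, \<beta>) \<Rightarrow>
        (\<Prod>s\<in>?U - \<alpha>. indet s) * (\<Prod>s\<in>?D. indet s) * (\<Prod>s\<in>?L - \<beta>. indet s)) = (\<Prod>s\<in>?C - \<mu>. indet s)"
      by simp
  next
    fix p
    assume "p \<in> ?I ?U \<times> ?I ?L"
    then obtain \<alpha> \<beta> where p: "p = (\<alpha>, \<beta>)"
      and \<alpha>: "initial_subshape \<alpha> ?U" and \<beta>: "initial_subshape \<beta> ?L"
      by auto
    note sub = initial_subshape_subset[OF \<alpha>] initial_subshape_subset[OF \<beta>]
    show "((case p of (\<alpha>, \<beta>) \<Rightarrow> ?Q \<union> \<alpha> \<union> \<beta>) \<inter> ?U, (case p of (\<alpha>, \<beta>) \<Rightarrow> ?Q \<union> \<alpha> \<union> \<beta>) \<inter> ?L) = p"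
      using sub disj unfolding p by auto
    show "(case p of (\<alpha>, \<beta>) \<Rightarrow> ?Q \<union> \<alpha> \<union> \<beta>) \<in> subshapes_cut_at lam i j k"
      using initial_subshape_glue[OF k \<alpha> \<beta>] sub disj
      unfolding p subshapes_cut_at_def by auto
  qed
  \<comment> \<open>Expanding the product of the two generating functions gives the same double sum
    with the order of \<alpha> and \<beta> exchanged.\<close>
  also have "\<dots> = skew_gf ?U * (\<Prod>s\<in>?D. indet s) * skew_gf ?L"
    unfolding skew_gf_def sum_distrib_right sum_distrib_left sum.cartesian_product[symmetric]
    by (rule sum.swap)
  finally show ?thesis .
qed

text \<open>The cut of \<mu> is the least k from \<open>max i j\<close> on with (k,k) outside \<mu>.
  It is at most d + 1 because (d + 1, d + 1) is not even in the diagram.\<close>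

lemma initial_subshapes_eq_Union_cut_at:
  assumes lam: "young_diagram lam" and d: "diagonal_length lam d"
    and ij: "1 \<le> i" "1 \<le> j" "i \<le> d + 1" "j \<le> d + 1"
  shows "{\<mu>. initial_subshape \<mu> (corner_region lam i j)} =
    (\<Union>k\<in>{max i j..d + 1}. subshapes_cut_at lam i j k)"
proof (intro equalityI subsetI)
  fix \<mu>
  assume "\<mu> \<in> {\<mu>. initial_subshape \<mu> (corner_region lam i j)}"
  then have \<mu>: "initial_subshape \<mu> (corner_region lam i j)"
    by simp
  note sub = initial_subshape_subset[OF \<mu>]
  have young: "(u', v') \<in> lam"
    if "(u, v) \<in> lam" "1 \<le> u'" "u' \<le> u" "1 \<le> v'" "v' \<le> v" for u v u' v'
    using lam that unfolding young_diagram_def by blast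
  define k where "k = (LEAST k. max i j \<le> k \<and> (k, k) \<notin> \<mu>)"
  have "(d + 1, d + 1) \<notin> \<mu>"
    using d sub by (auto simp: diagonal_length_def corner_region_def)
  with ij have ex: "max i j \<le> d + 1 \<and> (d + 1, d + 1) \<notin> \<mu>"
    by simp
  have k: "max i j \<le> k" "(k, k) \<notin> \<mu>"
    using LeastI[of "\<lambda>k. max i j \<le> k \<and> (k, k) \<notin> \<mu>", OF ex] by (simp_all add: k_def)
  have kd: "k \<le> d + 1"
    unfolding k_def by (rule Least_le[of "\<lambda>k. max i j \<le> k \<and> (k, k) \<notin> \<mu>", OF ex])
  have below: "(m, m) \<in> \<mu>" if "max i j \<le> m" "m < k" for m
    using not_less_Least[of m "\<lambda>k. max i j \<le> k \<and> (k, k) \<notin> \<mu>"] that by (simp add: k_def)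
  have "square_region lam i j k \<subseteq> \<mu>"
  proof clarify
    fix u v
    assume uv: "(u, v) \<in> square_region lam i j k"
    then have uv': "(u, v) \<in> corner_region lam i j" "i \<le> u" "u < k" "j \<le> v" "v < k"
      by (auto simp: region_defs)
    \<comment> \<open>A cell of the square forces \<open>max i j\<close> \<le> k - 1, so minimality
      of k applies. The cell (k - 1, k - 1) dominates the whole square.\<close>
    then have "(k - 1, k - 1) \<in> \<mu>"
      using k by (intro below) auto
    from initial_subshapeD[OF \<mu> this uv'(1)] uv' show "(u, v) \<in> \<mu>"
      by simp
  qed
  moreover have "\<mu> \<inter> corner_region lam k k = {}"
  proof (rule ccontr)
    assume "\<mu> \<inter> corner_region lam k k \<noteq> {}"
    then obtain u v where uv: "(u, v) \<in> \<mu>" "(u, v) \<in> lam" "k \<le> u" "k \<le> v"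
      by (auto simp: corner_region_def)
    \<comment> \<open>The Young property puts (k,k) in the diagram, being dominated by (u,v);
      closure of \<mu> would then put it in \<mu>.\<close>
    have "(k, k) \<in> corner_region lam i j"
      using young[OF uv(2), of k k] uv k ij by (auto simp: corner_region_def)
    from initial_subshapeD[OF \<mu> uv(1) this uv(3,4)] k show False
      by simp
  qed
  ultimately show "\<mu> \<in> (\<Union>k\<in>{max i j..d + 1}. subshapes_cut_at lam i j k)"
    using \<mu> k kd by (auto simp: subshapes_cut_at_def)
qed (auto simp: subshapes_cut_at_def)

text \<open>The cell (k,k) separates the two families: a cut at k excludes it, a cut at the larger l
  includes it.\<close>

lemma disjoint_cut_at:
  assumes lam: "young_diagram lam" and d: "diagonal_length lam d"
    and kl: "max i j \<le> k" "k < l" "1 \<le> k" "l \<le> d + 1"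
  shows "subshapes_cut_at lam i j k \<inter> subshapes_cut_at lam i j l = {}"
proof -
  \<comment> \<open>The bounds 1 \<le> k < l \<le> d + 1 rule out the case d = 0 of
    \<open>diagonal_length\<close>.\<close>
  have "(d, d) \<in> lam"
    using d kl by (auto simp: diagonal_length_def)
  moreover have "k \<le> d"
    using kl by simp
  ultimately have "(k, k) \<in> lam"
    using lam \<open>1 \<le> k\<close> unfolding young_diagram_def by blast
  with kl have "(k, k) \<in> square_region lam i j l" "(k, k) \<in> corner_region lam k k"
    by (auto simp: region_defs)
  then show ?thesis
    by (auto simp: subshapes_cut_at_def)
qed

text \<open>This is the matrix identity entry by entry, with indices from 1: the defining sum splits
  over the disjoint families of the possible cuts, and each part factors.\<close>

lemma skew_gf_corner_region:
  assumes lam: "young_diagram lam" and d: "diagonal_length lam d"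
    and ij: "1 \<le> i" "1 \<le> j" "i \<le> d + 1" "j \<le> d + 1"
  shows "skew_gf (corner_region lam i j) =
    (\<Sum>k = max i j..d + 1. skew_gf (upper_region lam i k) * (\<Prod>s\<in>corner_region lam k k. indet s) *
      skew_gf (lower_region lam k j))"
proof -
  have fin: "finite lam"
    using lam by (simp add: young_diagram_def)
  have "finite (corner_region lam i j)"
    by (rule finite_subset[OF _ fin]) (auto simp: corner_region_def)
  from finite_initial_subshapes[OF this]
  have fins: "finite (subshapes_cut_at lam i j k)" for k
    by (rule finite_subset[rotated]) (auto simp: subshapes_cut_at_def)
  have "skew_gf (corner_region lam i j) = (\<Sum>k = max i j..d + 1.
      \<Sum>\<mu>\<in>subshapes_cut_at lam i j k. \<Prod>s\<in>corner_region lam i j - \<mu>. indet s)"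
    unfolding skew_gf_def initial_subshapes_eq_Union_cut_at[OF assms]
  proof (rule sum.UNION_disjoint; (intro ballI impI)?)
    fix k l
    assume "k \<in> {max i j..d + 1}" "l \<in> {max i j..d + 1}" "k \<noteq> l"
    then show "subshapes_cut_at lam i j k \<inter> subshapes_cut_at lam i j l = {}"
      using disjoint_cut_at[OF lam d, of i j k l] disjoint_cut_at[OF lam d, of i j l k] ij
      by (cases k l rule: linorder_cases) auto
  qed (simp_all add: fins)
  also have "\<dots> = (\<Sum>k = max i j..d + 1. skew_gf (upper_region lam i k) *
      (\<Prod>s\<in>corner_region lam k k. indet s) * skew_gf (lower_region lam k j))"
    by (intro sum.cong refl sum_subshapes_cut_at fin) auto
  finally show ?thesis .
qed

text \<open>The diagonal factor only scales the columns of \<open>U_mat\<close>, so a single sum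
  over k remains. The zeros of the two triangular factors remove every k below
  \<open>max i j\<close>.\<close>

lemma UDL_entry:
  assumes "i < d + 1" "j < d + 1"
  shows "(U_mat lam d * D_mat lam d * L_mat lam d) $$ (i, j) =
    (\<Sum>k = max (Suc i) (Suc j)..d + 1. skew_gf (upper_region lam (Suc i) k) *
      (\<Prod>s\<in>corner_region lam k k. indet s) * skew_gf (lower_region lam k (Suc j)))"
    (is "_ = sum ?f _")
proof -
  have U: "U_mat lam d \<in> carrier_mat (d + 1) (d + 1)"
    by (simp add: U_mat_def)
  have "(U_mat lam d * D_mat lam d * L_mat lam d) $$ (i, j) =
      (\<Sum>k\<in>{0..<d + 1}. if i \<le> k \<and> j \<le> k then ?f (Suc k) else 0)"
    unfolding D_mat_def mat_diag_mult_right[OF U] using assms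
    by (auto simp: scalar_prod_def U_mat_def L_mat_def intro!: sum.cong)
  also have "\<dots> = (\<Sum>k\<in>{max i j..<d + 1}. ?f (Suc k))"
    by (rule sum.mono_neutral_cong_right) auto
  \<comment> \<open>Passage from matrix indices, starting at 0, to diagram indices, starting at
    1.\<close>
  also have "\<dots> = sum ?f {Suc (max i j)..<Suc (d + 1)}"
    by (rule sum.shift_bounds_Suc_ivl[symmetric])
  finally show ?thesis
    by (simp add: atLeastLessThanSuc_atLeastAtMost)
qed

theorem theorem5p1:
  fixes lam :: "cell set" and d :: nat
  assumes "young_diagram lam"
    and "diagonal_length lam d"
  shows "A_mat lam d = U_mat lam d * D_mat lam d * L_mat lam d
       \<and> upper_unitriangular (U_mat lam d)
       \<and> lower_unitriangular (L_mat lam d)"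
proof (intro conjI)
  show "A_mat lam d = U_mat lam d * D_mat lam d * L_mat lam d"
  proof (rule eq_matI)
    fix i j
    assume "i < dim_row (U_mat lam d * D_mat lam d * L_mat lam d)"
      "j < dim_col (U_mat lam d * D_mat lam d * L_mat lam d)"
    then have ij: "i < d + 1" "j < d + 1"
      by (simp_all add: U_mat_def L_mat_def)
    show "A_mat lam d $$ (i, j) = (U_mat lam d * D_mat lam d * L_mat lam d) $$ (i, j)"
      unfolding UDL_entry[OF ij] using ij skew_gf_corner_region[OF assms, of "Suc i" "Suc j"]
      by (simp add: A_mat_def)
  qed (simp_all add: A_mat_def U_mat_def L_mat_def)
  \<comment> \<open>The diagonal entries of both triangular factors are thus F of the empty set,
    which is 1.\<close>
  have "upper_region lam i i = {}" "lower_region lam i i = {}" for i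
    by (auto simp: region_defs)
  then show "upper_unitriangular (U_mat lam d)" "lower_unitriangular (L_mat lam d)"
    by (auto simp: upper_unitriangular_def lower_unitriangular_def U_mat_def L_mat_def
        upper_triangular_def)
qed

end
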